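(* Let $n\geq 1$ be an integer, let $a<b$ be real numbers, and let $f:[a,b]\to\mathbb{R}$ be $n$-times differentiable on $[a,b]$ with $f^{(n)}\in L[a,b]$. If $|f^{(n)}|$ is convex on $[a,b]$, then for all $x\in[a,b]$ $$\left|\int_a^b f(t)\,dt-\sum_{k=0}^{n-1}\left[\frac{(b-x)^{k+1}+(-1)^k(x-a)^{k+1}}{(k+1)!}\right]f^{(k)}(x)\right|$$ $$\leq \frac{1}{n!(b-a)}\left\{|f^{(n)}(a)|\left[\frac{(x-a)^{n+1}\left[(n+2)(b-x)+(x-a)\right]}{(n+1)(n+2)}+\frac{(b-x)^{n+2}}{n+2}\right]+|f^{(n)}(b)|\left[\frac{(b-x)^{n+1}\left[(n+2)(x-a)+(b-x)\right]}{(n+1)(n+2)}+\frac{(x-a)^{n+2}}{n+2}\right]\right\}.$$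
   Context: $f^{(k)}$ denotes the $k$-th derivative of $f$ (one-sided at the endpoints), with $f^{(0)}=f$; $L[a,b]$ is the space of Lebesgue integrable functions on $[a,b]$. *)

theory Defs
  imports "HOL-Analysis.Analysis"
begin

text \<open>
  Iterated derivative relative to a set \<open>S\<close>. All derivatives are taken within \<open>S\<close>, so for
  \<open>S = {a..b}\<close> with \<open>a < b\<close> they are the ordinary ones in the interior and one-sided at the
  endpoints, and only the values of \<open>f\<close> on \<open>S\<close> matter at points of \<open>S\<close>.
  The value is meaningful only where the derivative exists; see \<open>times_differentiable_on\<close>.
\<close>
primrec nth_deriv_within :: "real set \<Rightarrow> nat \<Rightarrow> (real \<Rightarrow> real) \<Rightarrow> real \<Rightarrow> real" where
  "nth_deriv_within S 0 f = f"
| "nth_deriv_within S (Suc k) f =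
     (\<lambda>x. vector_derivative (nth_deriv_within S k f) (at x within S))"

definition times_differentiable_on :: "nat \<Rightarrow> (real \<Rightarrow> real) \<Rightarrow> real set \<Rightarrow> bool" where
  "times_differentiable_on n f S \<longleftrightarrow> (\<forall>k<n. nth_deriv_within S k f differentiable_on S)"

end

theory Submission imports Defs begin

text \<open>
  The quantity to be bounded is a difference of two Taylor remainders. Let \<open>F\<close> be an antiderivative
  of \<open>f\<close>, and for a base point \<open>c\<close> let \<open>R c u\<close> be the error made when \<open>F c\<close> is replaced by its Taylor
  polynomial of degree \<open>n\<close> centred at \<open>u\<close>. Since \<open>(a - x)^(k+1) = - (-1)^k (x - a)^(k+1)\<close>, the
  expression inside the absolute value is exactly \<open>R b x - R a x\<close>.

  As a function of the centre, the remainder has a derivative with a single term,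
  \<open>- f\<^sup>(\<^sup>n\<^sup>)(u) (c - u)^n / n!\<close>, because the sum telescopes (\<open>taylor_sum_has_derivative\<close>), and it
  vanishes at \<open>u = c\<close>. Convexity puts \<open>\<bar>f\<^sup>(\<^sup>n\<^sup>)\<bar>\<close> below the chord through its values at \<open>a\<close> and \<open>b\<close>.
  So the derivative of the remainder is dominated by a polynomial whose antiderivative is written
  down explicitly (\<open>chord_majorant_has_derivative\<close>), and the mean value inequality
  for a dominated derivative bounds the remainder by the increment of that antiderivative, on
  \<open>{x..b}\<close> and on \<open>{a..x}\<close> (\<open>taylor_remainder_le\<close>). The right-hand side of the
  theorem is the sum of the two increments, collected by \<open>\<bar>f\<^sup>(\<^sup>n\<^sup>)(a)\<bar>\<close> and \<open>\<bar>f\<^sup>(\<^sup>n\<^sup>)(b)\<bar>\<close>.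
\<close>

section \<open>The Taylor remainder as a function of its centre\<close>

lemma nth_deriv_within_has_derivative:
  assumes "times_differentiable_on n f S" "k < n" "u \<in> S"
  shows "(nth_deriv_within S k f has_real_derivative nth_deriv_within S (Suc k) f u)
           (at u within S)"
proof -
  have "nth_deriv_within S k f differentiable (at u within S)"
    using assms by (auto simp: times_differentiable_on_def differentiable_on_def)
  then show ?thesis
    by (simp add: has_real_derivative_iff_has_vector_derivative vector_derivative_works)
qed

text \<open>
  Differentiating each product with respect to the centre \<open>u\<close> gives two consecutive terms of one
  sequence, so only the two ends survive.
\<close>

lemma taylor_sum_has_derivative:
  fixes G :: "nat \<Rightarrow> real \<Rightarrow> real"
  assumes "\<And>k. k < n \<Longrightarrow> (G k has_real_derivative G (Suc k) u) (at u within S)"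
  shows "((\<lambda>u. \<Sum>k<n. G k u * (c - u) ^ Suc k / fact (Suc k)) has_real_derivative
           G n u * (c - u) ^ n / fact n - G 0 u) (at u within S)"
proof -
  have term_deriv: "((\<lambda>u. G k u * (c - u) ^ Suc k / fact (Suc k)) has_real_derivative
          G (Suc k) u * (c - u) ^ Suc k / fact (Suc k) - G k u * (c - u) ^ k / fact k)
          (at u within S)" if "k < n" for k
  proof -
    have "((\<lambda>u. (c - u) ^ Suc k / fact (Suc k)) has_real_derivative
            - ((c - u) ^ k / fact k)) (at u within S)"
      by (rule derivative_eq_intros refl | simp)+
    from DERIV_mult[OF assms[OF that] this] show ?thesis
      by (simp add: algebra_simps)
  qed
  have "((\<lambda>u. \<Sum>k<n. G k u * (c - u) ^ Suc k / fact (Suc k)) has_real_derivative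
          (\<Sum>k<n. G (Suc k) u * (c - u) ^ Suc k / fact (Suc k) - G k u * (c - u) ^ k / fact k))
          (at u within S)"
    by (rule DERIV_sum) (use term_deriv in auto)
  also have "(\<Sum>k<n. G (Suc k) u * (c - u) ^ Suc k / fact (Suc k) - G k u * (c - u) ^ k / fact k)
      = G n u * (c - u) ^ n / fact n - G 0 u"
    by (subst sum_lessThan_telescope) simp
  finally show ?thesis .
qed

section \<open>An antiderivative for a power times a chord\<close>

text \<open>
  With \<open>{p, q} = {a, b}\<close> the quotient \<open>(A (q - u) + B (u - p)) / (q - p)\<close> is the chord with value
  \<open>A\<close> at \<open>p\<close> and \<open>B\<close> at \<open>q\<close>; the polynomial below is the
  antiderivative of \<open>(u - p)^n / n!\<close> times this chord that vanishes at \<open>p\<close>. Allowing \<open>q < p\<close> lets the same formula serve both halves of the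
  interval, with the power centred at the left or at the right endpoint.
\<close>

definition chord_majorant :: "nat \<Rightarrow> real \<Rightarrow> real \<Rightarrow> real \<Rightarrow> real \<Rightarrow> real \<Rightarrow> real" where
  "chord_majorant n p q A B u = 1 / (fact n * (q - p)) *
     (A * ((u - p) ^ (n + 1) * ((real n + 2) * (q - u) + (u - p)) / ((real n + 1) * (real n + 2)))
      + B * ((u - p) ^ (n + 2) / (real n + 2)))"

lemma chord_majorant_has_derivative:
  assumes "p \<noteq> q"
  shows "(chord_majorant n p q A B has_real_derivative
           (u - p) ^ n / fact n * ((A * (q - u) + B * (u - p)) / (q - p))) (at u within S)"
proof -
  have first: "((\<lambda>u. (u - p) ^ (n + 1) * ((real n + 2) * (q - u) + (u - p))
           / ((real n + 1) * (real n + 2))) has_real_derivative (u - p) ^ n * (q - u)) (at u within S)"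
  proof -
    have "((\<lambda>u. (u - p) ^ (n + 1) * ((real n + 2) * (q - u) + (u - p))
             / ((real n + 1) * (real n + 2))) has_real_derivative
           ((real n + 1) * (u - p) ^ n * ((real n + 2) * (q - u) + (u - p))
             + (u - p) ^ (n + 1) * (- (real n + 2) + 1)) / ((real n + 1) * (real n + 2)))
           (at u within S)"
      by (rule derivative_eq_intros refl | simp)+
    also have "(real n + 1) * (u - p) ^ n * ((real n + 2) * (q - u) + (u - p))
             + (u - p) ^ (n + 1) * (- (real n + 2) + 1)
           = ((real n + 1) * (real n + 2)) * ((u - p) ^ n * (q - u))"
      by (simp add: algebra_simps)
    also have "\<dots> / ((real n + 1) * (real n + 2)) = (u - p) ^ n * (q - u)"
      by (rule nonzero_mult_div_cancel_left) (simp add: add_eq_0_iff)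
    finally show ?thesis .
  qed
  have second: "((\<lambda>u. (u - p) ^ (n + 2) / (real n + 2)) has_real_derivative (u - p) ^ n * (u - p))
      (at u within S)"
    by (rule derivative_eq_intros refl | simp)+ (simp add: field_simps)
  have "(chord_majorant n p q A B has_real_derivative
          1 / (fact n * (q - p)) * (A * ((u - p) ^ n * (q - u)) + B * ((u - p) ^ n * (u - p))))
        (at u within S)"
    unfolding chord_majorant_def by (intro DERIV_cmult DERIV_add first second)
  also have "1 / (fact n * (q - p)) * (A * ((u - p) ^ n * (q - u)) + B * ((u - p) ^ n * (u - p)))
      = (u - p) ^ n / fact n * ((A * (q - u) + B * (u - p)) / (q - p))"
    using assms by (simp add: field_simps)
  finally show ?thesis .
qed

text \<open>Exchanging the endpoints turns every difference into its negative; the signs collect to the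
  prefactor.\<close>

lemma chord_majorant_swap:
  "(- 1) ^ Suc n * chord_majorant n b a B A x = 1 / (fact n * (b - a)) *
     (A * ((b - x) ^ (n + 2) / (real n + 2))
      + B * ((b - x) ^ (n + 1) * ((real n + 2) * (x - a) + (b - x)) / ((real n + 1) * (real n + 2))))"
proof -
  have rearrange: "- s * (- C * (B * (- (s * E) * - L / q) + A * (s * D / r)))
      = (s * s) * (C * (A * (D / r) + B * (E * L / q)))" for s C E L q D r :: real
    by (simp add: algebra_simps)
  have sign: "(- 1 :: real) ^ n * (- 1) ^ n = 1"
    by (simp flip: power_mult_distrib)
  have pow: "(x - b) ^ m = (- 1) ^ m * (b - x) ^ m" for m
    by (simp flip: power_mult_distrib)
  have "(x - b) ^ (n + 1) = - ((- 1) ^ n * (b - x) ^ (n + 1))"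
    "(x - b) ^ (n + 2) = (- 1) ^ n * (b - x) ^ (n + 2)"
    by (simp_all only: pow[of "n + 1"] pow[of "n + 2"]) simp_all
  moreover have "(real n + 2) * (a - x) + (x - b) = - ((real n + 2) * (x - a) + (b - x))"
    by (simp add: algebra_simps)
  moreover have "1 / (fact n * (a - b)) = - (1 / (fact n * (b - a)))"
    by (metis minus_diff_eq minus_divide_right mult_minus_right)
  moreover have "(- 1 :: real) ^ Suc n = - ((- 1) ^ n)"
    by simp
  ultimately show ?thesis
    unfolding chord_majorant_def by (simp only: rearrange sign mult_1_left)
qed

lemma convex_on_le_chord:
  fixes g :: "real \<Rightarrow> real"
  assumes "convex_on {a..b} g" "a < b" "u \<in> {a..b}"
  shows "g u \<le> (g a * (b - u) + g b * (u - a)) / (b - a)"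
proof -
  have "g u \<le> (g b - g a) / (b - a) * (u - a) + g a"
    using assms by (intro convex_onD_Icc') auto
  also have "\<dots> = (g a * (b - u) + g b * (u - a)) / (b - a)"
    using assms(2) by (simp add: field_simps)
  finally show ?thesis .
qed

section \<open>Bounding the remainder\<close>

text \<open>
  The mean value inequality for a dominated derivative, with derivatives relative to a set
  that may be larger than \<open>{l..r}\<close> and with degenerate intervals allowed.
\<close>

lemma increment_le_dominated:
  fixes \<phi> \<psi> :: "real \<Rightarrow> real"
  assumes "l \<le> r" "{l..r} \<subseteq> S"
    and \<phi>: "\<And>u. u \<in> S \<Longrightarrow> (\<phi> has_real_derivative \<phi>' u) (at u within S)"
    and \<psi>: "\<And>u. u \<in> S \<Longrightarrow> (\<psi> has_real_derivative \<psi>' u) (at u within S)"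
    and le: "\<And>u. u \<in> {l..r} \<Longrightarrow> \<bar>\<phi>' u\<bar> \<le> \<psi>' u"
  shows "\<bar>\<phi> r - \<phi> l\<bar> \<le> \<psi> r - \<psi> l"
proof (cases "l = r")
  case False
  with \<open>l \<le> r\<close> have "l < r" by simp
  have on_Icc: "(\<phi> has_real_derivative \<phi>' u) (at u within {l..r})"
      "(\<psi> has_real_derivative \<psi>' u) (at u within {l..r})" if "u \<in> {l..r}" for u
    using that \<phi> \<psi> assms(2) by (meson DERIV_subset subsetD)+
  have "norm (\<phi> r - \<phi> l) \<le> \<psi> r - \<psi> l"
  proof (rule differentiable_bound_general[OF \<open>l < r\<close>])
    show "continuous_on {l..r} \<phi>" "continuous_on {l..r} \<psi>"
      by (blast intro: DERIV_continuous_on on_Icc)+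
    show "(\<phi> has_vector_derivative \<phi>' u) (at u)" "(\<psi> has_vector_derivative \<psi>' u) (at u)"
      if "l < u" "u < r" for u
      using on_Icc[of u] that
      by (simp_all add: at_within_Icc_at flip: has_real_derivative_iff_has_vector_derivative)
    show "norm (\<phi>' u) \<le> \<psi>' u" if "l < u" "u < r" for u
      using le[of u] that by simp
  qed
  then show ?thesis by simp
qed simp

text \<open>
  Taylor's theorem with the remainder controlled by the chord of \<open>\<bar>G n\<bar>\<close>. The sequence \<open>G\<close> consists of
  the successive derivatives of \<open>F\<close>, starting with the first one; the
  two bounds are for the values of \<open>F\<close> at the two endpoints. For \<open>b\<close> the majorant has its endpoints
  exchanged: turning \<open>(u - b)^n\<close> into \<open>(b - u)^n\<close> costs the sign \<open>(- 1)^n\<close>, and one more sign arises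
  because the increment over \<open>{x..b}\<close> takes the value at \<open>x\<close> with a minus.
\<close>

lemma taylor_remainder_le:
  fixes G :: "nat \<Rightarrow> real \<Rightarrow> real"
  assumes "a < b" "x \<in> {a..b}"
    and F: "\<And>u. u \<in> {a..b} \<Longrightarrow> (F has_real_derivative G 0 u) (at u within {a..b})"
    and G: "\<And>k u. k < n \<Longrightarrow> u \<in> {a..b} \<Longrightarrow> (G k has_real_derivative G (Suc k) u) (at u within {a..b})"
    and "convex_on {a..b} (\<lambda>t. \<bar>G n t\<bar>)"
  defines "R \<equiv> \<lambda>c u. F c - F u - (\<Sum>k<n. G k u * (c - u) ^ Suc k / fact (Suc k))"
  shows "\<bar>R a x\<bar> \<le> chord_majorant n a b \<bar>G n a\<bar> \<bar>G n b\<bar> x"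
    and "\<bar>R b x\<bar> \<le> (- 1) ^ Suc n * chord_majorant n b a \<bar>G n b\<bar> \<bar>G n a\<bar> x"
proof -
  define h where "h u = (\<bar>G n a\<bar> * (b - u) + \<bar>G n b\<bar> * (u - a)) / (b - a)" for u
  have chord: "\<bar>G n u\<bar> \<le> h u" if "u \<in> {a..b}" for u
    using convex_on_le_chord[OF assms(5,1) that] by (simp add: h_def)
  have R_deriv: "(R c has_real_derivative - (G n u * (c - u) ^ n / fact n)) (at u within {a..b})"
    if "u \<in> {a..b}" for c u
    unfolding R_def
    by (rule derivative_eq_intros F taylor_sum_has_derivative[of n G] G that refl | simp)+
  have R_base: "R c c = 0" for c
    by (simp add: R_def)
  have dominated: "\<bar>- (G n u * (c - u) ^ n / fact n)\<bar> \<le> \<bar>c - u\<bar> ^ n / fact n * h u"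
    if "u \<in> {a..b}" for c u
    using mult_left_mono[OF chord[OF that], of "\<bar>c - u\<bar> ^ n / fact n"]
    by (simp add: abs_mult power_abs mult.commute)
  show "\<bar>R a x\<bar> \<le> chord_majorant n a b \<bar>G n a\<bar> \<bar>G n b\<bar> x"
  proof -
    have "\<bar>R a x - R a a\<bar> \<le> chord_majorant n a b \<bar>G n a\<bar> \<bar>G n b\<bar> x
        - chord_majorant n a b \<bar>G n a\<bar> \<bar>G n b\<bar> a"
    proof (rule increment_le_dominated[OF _ _ R_deriv])
      show "(chord_majorant n a b \<bar>G n a\<bar> \<bar>G n b\<bar> has_real_derivative
          (u - a) ^ n / fact n * h u) (at u within {a..b})" for u
        unfolding h_def using \<open>a < b\<close> by (intro chord_majorant_has_derivative) simp
      show "\<bar>- (G n u * (a - u) ^ n / fact n)\<bar> \<le> (u - a) ^ n / fact n * h u"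
        if "u \<in> {a..x}" for u
        using dominated[of u a] that assms(2) by simp
    qed (use assms(2) in auto)
    then show ?thesis
      by (simp add: R_base chord_majorant_def)
  qed
  show "\<bar>R b x\<bar> \<le> (- 1) ^ Suc n * chord_majorant n b a \<bar>G n b\<bar> \<bar>G n a\<bar> x"
  proof -
    let ?M = "\<lambda>u. (- 1) ^ n * chord_majorant n b a \<bar>G n b\<bar> \<bar>G n a\<bar> u"
    have "\<bar>R b b - R b x\<bar> \<le> ?M b - ?M x"
    proof (rule increment_le_dominated[OF _ _ R_deriv])
      show "(?M has_real_derivative (b - u) ^ n / fact n * h u) (at u within {a..b})" for u
      proof -
        have "(?M has_real_derivative (- 1) ^ n * ((u - b) ^ n / fact n *
            ((\<bar>G n b\<bar> * (a - u) + \<bar>G n a\<bar> * (u - b)) / (a - b)))) (at u within {a..b})"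
          using \<open>a < b\<close> by (intro DERIV_cmult chord_majorant_has_derivative) simp
        moreover have "(\<bar>G n b\<bar> * (a - u) + \<bar>G n a\<bar> * (u - b)) / (a - b) = h u"
          using \<open>a < b\<close> by (simp add: h_def field_simps)
        moreover have "(- 1) ^ n * (u - b) ^ n = (b - u) ^ n"
          by (simp flip: power_mult_distrib)
        ultimately show ?thesis
          by (metis mult.assoc times_divide_eq_right)
      qed
      show "\<bar>- (G n u * (b - u) ^ n / fact n)\<bar> \<le> (b - u) ^ n / fact n * h u"
        if "u \<in> {x..b}" for u
        using dominated[of u b] that assms(2) by simp
    qed (use assms(2) in auto)
    then show ?thesis
      by (simp add: R_base chord_majorant_def)
  qed
qed

theorem theorem2:
  fixes f :: "real \<Rightarrow> real" and a b :: real and n :: nat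
  assumes "n \<ge> 1" and "a < b"
    and "times_differentiable_on n f {a..b}"
    and "nth_deriv_within {a..b} n f absolutely_integrable_on {a..b}"
    and "convex_on {a..b} (\<lambda>t. \<bar>nth_deriv_within {a..b} n f t\<bar>)"
  shows "\<forall>x\<in>{a..b}.
    \<bar>integral {a..b} f
      - (\<Sum>k<n. ((b - x) ^ (k + 1) + (-1) ^ k * (x - a) ^ (k + 1)) / fact (k + 1)
                * nth_deriv_within {a..b} k f x)\<bar>
    \<le> 1 / (fact n * (b - a)) *
      (\<bar>nth_deriv_within {a..b} n f a\<bar> *
         ((x - a) ^ (n + 1) * ((real n + 2) * (b - x) + (x - a)) / ((real n + 1) * (real n + 2))
          + (b - x) ^ (n + 2) / (real n + 2))
       + \<bar>nth_deriv_within {a..b} n f b\<bar> *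
         ((b - x) ^ (n + 1) * ((real n + 2) * (x - a) + (b - x)) / ((real n + 1) * (real n + 2))
          + (x - a) ^ (n + 2) / (real n + 2)))"
proof
  fix x assume x: "x \<in> {a..b}"
  let ?G = "\<lambda>k. nth_deriv_within {a..b} k f"
  define F where "F u = integral {a..u} f" for u
  have G: "(?G k has_real_derivative ?G (Suc k) u) (at u within {a..b})"
    if "k < n" "u \<in> {a..b}" for k u
    using nth_deriv_within_has_derivative[OF assms(3) that] .
  have "continuous_on {a..b} f"
    using G[of 0] assms(1) by (intro DERIV_continuous_on[where D = "?G 1"]) simp
  then have F: "(F has_real_derivative ?G 0 u) (at u within {a..b})" if "u \<in> {a..b}" for u
    unfolding F_def using integral_has_real_derivative that by simp
  define R where
    "R c = F c - F x - (\<Sum>k<n. ?G k x * (c - x) ^ Suc k / fact (Suc k))" for c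
  have left: "\<bar>R a\<bar> \<le> chord_majorant n a b \<bar>?G n a\<bar> \<bar>?G n b\<bar> x"
    and right: "\<bar>R b\<bar> \<le> (- 1) ^ Suc n * chord_majorant n b a \<bar>?G n b\<bar> \<bar>?G n a\<bar> x"
    unfolding R_def
    using taylor_remainder_le[of a b x F ?G n, OF assms(2) x F G assms(5)] by simp_all

  have power_left: "(a - x) ^ Suc k = - ((- 1) ^ k * (x - a) ^ Suc k)" for k
  proof -
    have "(a - x) ^ Suc k = (- 1) ^ Suc k * (x - a) ^ Suc k"
      by (simp only: power_mult_distrib[symmetric]) simp
    then show ?thesis by simp
  qed
  have "integral {a..b} f - (\<Sum>k<n. ((b - x) ^ (k + 1) + (-1) ^ k * (x - a) ^ (k + 1)) / fact (k + 1)
          * ?G k x) = R b - R a"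
  proof -
    have "(\<Sum>k<n. ((b - x) ^ (k + 1) + (-1) ^ k * (x - a) ^ (k + 1)) / fact (k + 1) * ?G k x)
      = (\<Sum>k<n. ?G k x * (b - x) ^ Suc k / fact (Suc k) - ?G k x * (a - x) ^ Suc k / fact (Suc k))"
      unfolding power_left
      by (intro sum.cong refl) (simp add: add_divide_distrib algebra_simps del: power_Suc fact_Suc)
    then show ?thesis
      by (simp add: R_def F_def sum_subtractf)
  qed
  then have "\<bar>integral {a..b} f - (\<Sum>k<n. ((b - x) ^ (k + 1) + (-1) ^ k * (x - a) ^ (k + 1)) / fact (k + 1)
          * ?G k x)\<bar> \<le> \<bar>R a\<bar> + \<bar>R b\<bar>"
    by simp
  also have "\<dots> \<le> chord_majorant n a b \<bar>?G n a\<bar> \<bar>?G n b\<bar> x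
      + (- 1) ^ Suc n * chord_majorant n b a \<bar>?G n b\<bar> \<bar>?G n a\<bar> x"
    using left right by (rule add_mono)
  also have "\<dots> = 1 / (fact n * (b - a)) *
      (\<bar>?G n a\<bar> *
         ((x - a) ^ (n + 1) * ((real n + 2) * (b - x) + (x - a)) / ((real n + 1) * (real n + 2))
          + (b - x) ^ (n + 2) / (real n + 2))
       + \<bar>?G n b\<bar> *
         ((b - x) ^ (n + 1) * ((real n + 2) * (x - a) + (b - x)) / ((real n + 1) * (real n + 2))
          + (x - a) ^ (n + 2) / (real n + 2)))"
    unfolding chord_majorant_swap
    unfolding chord_majorant_def distrib_left[symmetric]
    by (simp only: distrib_left add.assoc add.commute add.left_commute)
  finally show "\<bar>integral {a..b} f
      - (\<Sum>k<n. ((b - x) ^ (k + 1) + (-1) ^ k * (x - a) ^ (k + 1)) / fact (k + 1) * ?G k x)\<bar>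
    \<le> \<dots>" .
qed

end
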